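(* Let $\mathcal C$ be a non-degenerate cubic in $\mathbb R^2$ and let $\mathcal C_0$ denote its embedding in $\mathbb{CP}^2$. Then the following two conditions are equivalent: (1) There exist distinct points $A,B,C,D\in\mathcal C$ such that $\mathcal C$ is the isogonal cubic of $ABCD$. (2) The circular points at infinity $I=(1:i:0)$ and $J=(1:-i:0)$ lie on $\mathcal C_0$, and the tangents to $\mathcal C_0$ at $I$ and $J$ meet at a point of $\mathcal C_0$.
   Context: A cubic in $\mathbb R^2$ is the zero set of a real polynomial of degree 3; its embedding in $\mathbb{CP}^2$ is the complex projective curve given by the homogenized equation. A cubic is non-degenerate if it is irreducible (it does not contain a line as a component). For points $X,A,B,C,D\in\mathbb R^2$, the pairs of lines $(XA,XC)$ and $(XB,XD)$ are called isogonal if they have the same pair of angle bisectors. For distinct points $A,B,C,D\in\mathbb R^2$, the isogonal cubic of $ABCD$ is the locus of points $X$ such that $(XA,XC)$ and $(XB,XD)$ are isogonal; identifying $\mathbb R^2$ with the complex plane and writing lower-case letters for complex coordinates, it is the curve with equation $(x-b)(x-d)\,\overline{(x-a)(x-c)}=\overline{(x-b)(x-d)}\,(x-a)(x-c)$ (the degree-4 terms cancel). It passes through $A,B,C,D$. *)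

theory Defs
  imports "HOL-Analysis.Analysis" "HOL-Computational_Algebra.Polynomial"
begin

section \<open>Plane curves and their projective closures\<close>

text \<open>
  A polynomial in \<open>\<real>[x,y]\<close> is an element of \<open>\<real>[x][y]\<close>: the coefficient of \<open>x\<^sup>i y\<^sup>j\<close> in
  \<open>F\<close> is \<open>coeff (coeff F j) i\<close>. The plane \<open>\<real>\<^sup>2\<close> is identified with \<^typ>\<open>complex\<close>.
\<close>

definition total_degree :: "'a::zero poly poly \<Rightarrow> nat" where
  "total_degree F = Max (insert 0 {i + j | i j. coeff (coeff F j) i \<noteq> 0})"

definition plane_curve :: "real poly poly \<Rightarrow> complex set" where
  "plane_curve F = {p. poly (poly F [:Im p:]) (Re p) = 0}"

definition homogenization :: "real poly poly \<Rightarrow> complex ^ 3 \<Rightarrow> complex" where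
  "homogenization F v =
     (\<Sum>j\<le>degree F. \<Sum>i\<le>degree (coeff F j).
        of_real (coeff (coeff F j) i) * (v $ 1) ^ i * (v $ 2) ^ j * (v $ 3) ^ (total_degree F - i - j))"

definition partial_deriv :: "3 \<Rightarrow> (complex ^ 3 \<Rightarrow> complex) \<Rightarrow> complex ^ 3 \<Rightarrow> complex" where
  "partial_deriv k f v = deriv (\<lambda>t. f (\<chi> l. if l = k then t else v $ l)) (v $ k)"

definition proj_rel :: "complex ^ 3 \<Rightarrow> complex ^ 3 \<Rightarrow> bool" where
  "proj_rel u v \<longleftrightarrow> u \<noteq> 0 \<and> v \<noteq> 0 \<and> (\<exists>c. c \<noteq> 0 \<and> v = c *s u)"

lemma part_equivp_proj_rel: "part_equivp proj_rel"
proof (rule part_equivpI)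
  show "\<exists>x. proj_rel x x"
    by (rule exI[of _ "1"]) (auto simp: proj_rel_def vec_eq_iff intro!: exI[of _ 1])
  show "symp proj_rel"
  proof (rule sympI)
    fix u v assume "proj_rel u v"
    then obtain c where c: "u \<noteq> 0" "v \<noteq> 0" "c \<noteq> 0" "v = c *s u" by (auto simp: proj_rel_def)
    then have "u = inverse c *s v" by (simp add: vec_eq_iff)
    with c show "proj_rel v u" unfolding proj_rel_def by (metis nonzero_imp_inverse_nonzero)
  qed
  show "transp proj_rel"
  proof (rule transpI)
    fix u v w assume "proj_rel u v" "proj_rel v w"
    then obtain c d where "u \<noteq> 0" "w \<noteq> 0" "c \<noteq> 0" "v = c *s u" "d \<noteq> 0" "w = d *s v"
      by (auto simp: proj_rel_def)
    then show "proj_rel u w" unfolding proj_rel_def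
      by (auto intro!: exI[of _ "d * c"] simp: vec_eq_iff)
  qed
qed

quotient_type cp2 = "complex ^ 3" / partial: proj_rel
  by (rule part_equivp_proj_rel)

lemma le_total_degree:
  assumes "coeff (coeff F j) i \<noteq> 0"
  shows "i + j \<le> total_degree F"
proof -
  have "{i + j | i j. coeff (coeff F j) i \<noteq> 0}
      \<subseteq> (\<Union>j\<in>{..degree F}. \<Union>i\<in>{..degree (coeff F j)}. {i + j})"
  proof
    fix n assume "n \<in> {i + j | i j. coeff (coeff F j) i \<noteq> 0}"
    then obtain i j where n: "n = i + j" "coeff (coeff F j) i \<noteq> 0" by auto
    then have "coeff F j \<noteq> 0" by auto
    with n have "j \<in> {..degree F}" "i \<in> {..degree (coeff F j)}" by (auto intro: le_degree)
    with n(1) show "n \<in> (\<Union>j\<in>{..degree F}. \<Union>i\<in>{..degree (coeff F j)}. {i + j})" by blast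
  qed
  then have "finite {i + j | i j. coeff (coeff F j) i \<noteq> 0}"
    by (rule finite_subset) auto
  then show ?thesis using assms unfolding total_degree_def by (intro Max_ge) auto
qed

lemma homogenization_scale:
  "homogenization F (c *s v) = c ^ total_degree F * homogenization F v"
proof -
  have "of_real (coeff (coeff F j) i) * (c * v $ 1) ^ i * (c * v $ 2) ^ j * (c * v $ 3) ^ (total_degree F - i - j)
      = c ^ total_degree F * (of_real (coeff (coeff F j) i) * (v $ 1) ^ i * (v $ 2) ^ j
          * (v $ 3) ^ (total_degree F - i - j))" for i j
  proof (cases "coeff (coeff F j) i = 0")
    case False
    then have "c ^ total_degree F = c ^ i * c ^ j * c ^ (total_degree F - i - j)"
      using le_total_degree[OF False] by (simp flip: power_add)
    then show ?thesis by (simp add: power_mult_distrib)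
  qed simp
  then show ?thesis
    by (simp only: homogenization_def sum_distrib_left vector_smult_component)
qed

lemma homogenization_field_differentiable:
  "(\<lambda>t. homogenization F (\<chi> l. if l = k then t else v $ l)) field_differentiable at x"
proof -
  have "(\<lambda>t. (\<chi> l. if l = k then t else v $ l) $ m) field_differentiable at x" for m
    by (cases "m = k") simp_all
  then show ?thesis unfolding homogenization_def
    by (intro field_differentiable_sum field_differentiable_mult field_differentiable_power
        field_differentiable_const)
qed

lemma partial_deriv_homogenization_scale:
  assumes "c \<noteq> 0"
  shows "c * partial_deriv k (homogenization F) (c *s v)
    = c ^ total_degree F * partial_deriv k (homogenization F) v"
proof -
  define g where "g = (\<lambda>t. homogenization F (\<chi> l. if l = k then t else v $ l))"
  define h where "h = (\<lambda>t. homogenization F (\<chi> l. if l = k then t else (c *s v) $ l))"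
  have eq: "h = (\<lambda>t. c ^ total_degree F * g (t / c))"
  proof
    fix t
    have "(\<chi> l. if l = k then t else (c *s v) $ l) = c *s (\<chi> l. if l = k then t / c else v $ l)"
      using assms by (simp add: vec_eq_iff)
    then show "h t = c ^ total_degree F * g (t / c)"
      unfolding h_def g_def by (simp only: homogenization_scale)
  qed
  have "(g has_field_derivative deriv g (v $ k)) (at (c * v $ k / c))"
    using homogenization_field_differentiable[of F k v "v $ k"] assms
    unfolding g_def by (simp add: DERIV_deriv_iff_field_differentiable)
  moreover have "((\<lambda>t. t / c) has_field_derivative 1 / c) (at (c * v $ k))"
    by (rule DERIV_cdivide) (rule DERIV_ident)
  ultimately have "((\<lambda>t. g (t / c)) has_field_derivative deriv g (v $ k) * (1 / c)) (at (c * v $ k))"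
    by (rule DERIV_chain2)
  then have "(h has_field_derivative c ^ total_degree F * (deriv g (v $ k) * (1 / c))) (at (c * v $ k))"
    unfolding eq by (rule DERIV_cmult)
  then have "deriv h (c * v $ k) = c ^ total_degree F * (deriv g (v $ k) * (1 / c))"
    by (rule DERIV_imp_deriv)
  then show ?thesis using assms unfolding partial_deriv_def g_def h_def by simp
qed

lift_definition on_proj_curve :: "real poly poly \<Rightarrow> cp2 \<Rightarrow> bool"
  is "\<lambda>F v. homogenization F v = 0"
  by (auto simp: proj_rel_def homogenization_scale)

text \<open>
  The tangent at a point with homogeneous coordinates \<open>u\<close> is the line with the equation
  \<open>\<partial>\<^sub>1 u v\<^sub>1 + \<partial>\<^sub>2 u v\<^sub>2 + \<partial>\<^sub>3 u v\<^sub>3 = 0\<close>. This is meaningful at nonsingular points only. The circular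
  points are never singular on an irreducible real cubic: they are complex conjugate, so both
  would be singular, and the line at infinity would meet the cubic there with multiplicity
  at least 4.
\<close>

lift_definition on_tangent :: "real poly poly \<Rightarrow> cp2 \<Rightarrow> cp2 \<Rightarrow> bool"
  is "\<lambda>F u v. (\<Sum>k\<in>UNIV. partial_deriv k (homogenization F) u * v $ k) = 0"
proof -
  fix F u u' v v' assume "proj_rel u u'" "proj_rel v v'"
  then obtain c d where cd: "c \<noteq> 0" "u' = c *s u" "d \<noteq> 0" "v' = d *s v"
    by (auto simp: proj_rel_def)
  define S where "S = (\<Sum>k\<in>UNIV. partial_deriv k (homogenization F) u * v $ k)"
  define S' where "S' = (\<Sum>k\<in>UNIV. partial_deriv k (homogenization F) u' * v' $ k)"
  have "c * S' = (\<Sum>k\<in>UNIV. (c * partial_deriv k (homogenization F) (c *s u)) * (d * v $ k))"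
    using cd by (simp add: S'_def sum_distrib_left mult.assoc)
  then have "c * S' = c ^ total_degree F * d * S"
    using cd by (simp add: S_def partial_deriv_homogenization_scale sum_distrib_left mult_ac)
  with cd(1,3) have "S = 0 \<longleftrightarrow> S' = 0"
    by (metis mult_eq_0_iff power_not_zero)
  then show "((\<Sum>k\<in>UNIV. partial_deriv k (homogenization F) u * v $ k) = 0)
      = ((\<Sum>k\<in>UNIV. partial_deriv k (homogenization F) u' * v' $ k) = 0)"
    unfolding S_def S'_def .
qed

definition proj_curve :: "real poly poly \<Rightarrow> cp2 set" where
  "proj_curve F = {P. on_proj_curve F P}"

definition tangent_line :: "real poly poly \<Rightarrow> cp2 \<Rightarrow> cp2 set" where
  "tangent_line F P = {Q. on_tangent F P Q}"

lift_definition circular_I :: cp2 is "vector [1, \<i>, 0]"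
  by (simp add: proj_rel_def vec_eq_iff forall_3)

lift_definition circular_J :: cp2 is "vector [1, - \<i>, 0]"
  by (simp add: proj_rel_def vec_eq_iff forall_3)


section \<open>The isogonal cubic\<close>

definition reflection :: "complex set \<Rightarrow> complex \<Rightarrow> complex" where
  "reflection n p = 2 *\<^sub>R closest_point n p - p"

text \<open>
  The angle bisectors at \<open>X\<close> of two lines \<open>l\<close>, \<open>m\<close> through \<open>X\<close> are the lines through \<open>X\<close> whose
  reflection takes \<open>l\<close> to \<open>m\<close>; if \<open>l = m\<close>, they are \<open>l\<close> itself and its perpendicular at \<open>X\<close>.
\<close>

definition angle_bisectors :: "complex \<Rightarrow> complex set \<Rightarrow> complex set \<Rightarrow> complex set set" where
  "angle_bisectors X l m =
     {n. (\<exists>P. P \<noteq> X \<and> n = affine hull {X, P}) \<and> reflection n ` l = m}"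

definition isogonal :: "complex \<Rightarrow> complex \<Rightarrow> complex \<Rightarrow> complex \<Rightarrow> complex \<Rightarrow> bool" where
  "isogonal X A B C D \<longleftrightarrow>
     angle_bisectors X (affine hull {X, A}) (affine hull {X, C}) =
     angle_bisectors X (affine hull {X, B}) (affine hull {X, D})"

text \<open>
  At \<open>X \<in> {A, B, C, D}\<close> one of the four lines is undefined. These points belong to the curve, as
  \<open>isogonal_cubic_eq\<close> below shows.
\<close>

definition isogonal_cubic :: "complex \<Rightarrow> complex \<Rightarrow> complex \<Rightarrow> complex \<Rightarrow> complex set" where
  "isogonal_cubic A B C D = {X. X \<in> {A, B, C, D} \<or> isogonal X A B C D}"

lemma line_unit:
  fixes X P :: complex
  assumes "P \<noteq> X"
  obtains w where "norm w = 1" "affine hull {X, P} = range (\<lambda>t. X + of_real t * w)"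
proof
  define w where "w = (P - X) / norm (P - X)"
  show "norm w = 1" using assms by (simp add: w_def norm_divide)
  have w: "P - X = of_real (norm (P - X)) * w" using assms by (simp add: w_def)
  show "affine hull {X, P} = range (\<lambda>t. X + of_real t * w)"
    unfolding affine_hull_2_alt
  proof (intro equalityI subsetI)
    fix y assume "y \<in> range (\<lambda>u. X + u *\<^sub>R (P - X))"
    then obtain u where "y = X + of_real u * (P - X)" by (auto simp: scaleR_conv_of_real)
    then have "y = X + of_real (u * norm (P - X)) * w" by (subst (asm) w) simp
    then show "y \<in> range (\<lambda>t. X + of_real t * w)" by blast
  next
    fix y assume "y \<in> range (\<lambda>t. X + of_real t * w)"
    then obtain t where "y = X + of_real t * w" by auto
    then have "y = X + (t / norm (P - X)) *\<^sub>R (P - X)"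
      by (simp add: w_def scaleR_conv_of_real)
    then show "y \<in> range (\<lambda>u. X + u *\<^sub>R (P - X))" by blast
  qed
qed

lemma reflection_line:
  fixes X w :: complex
  assumes "norm w = 1"
  shows "reflection (range (\<lambda>t. X + of_real t * w)) p = X + w\<^sup>2 * cnj (p - X)"
proof -
  let ?n = "range (\<lambda>t. X + of_real t * w)"
  let ?s = "(p - X) \<bullet> w"
  have n: "?n = affine hull {X, X + w}"
    by (simp add: affine_hull_2_alt scaleR_conv_of_real)
  have ww: "w \<bullet> w = 1" using assms by (simp add: dot_square_norm)
  have "X + of_real ?s * w = closest_point ?n p"
  proof (rule closest_point_unique)
    show "convex ?n" "closed ?n" unfolding n by (auto simp: affine_imp_convex)
    show "\<forall>z\<in>?n. dist p (X + of_real ?s * w) \<le> dist p z"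
    proof
      fix z assume "z \<in> ?n"
      then obtain t where z: "z = X + t *\<^sub>R w" by (auto simp: scaleR_conv_of_real)
      define q where "q = p - X"
      have "(q - (q \<bullet> w) *\<^sub>R w) \<bullet> (q - (q \<bullet> w) *\<^sub>R w) + (q \<bullet> w - t)\<^sup>2 = (q - t *\<^sub>R w) \<bullet> (q - t *\<^sub>R w)"
        using ww by (simp add: inner_diff inner_commute power2_eq_square algebra_simps)
      then have "(norm (q - (q \<bullet> w) *\<^sub>R w))\<^sup>2 \<le> (norm (q - t *\<^sub>R w))\<^sup>2"
        unfolding power2_norm_eq_inner by (smt (verit) zero_le_power2)
      then have "norm (q - (q \<bullet> w) *\<^sub>R w) \<le> norm (q - t *\<^sub>R w)"
        by (rule power2_le_imp_le) simp
      then show "dist p (X + of_real ?s * w) \<le> dist p z"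
        by (simp add: z q_def dist_norm scaleR_conv_of_real algebra_simps)
    qed
  qed auto
  then have "reflection ?n p = 2 *\<^sub>R (X + of_real ?s * w) - p"
    by (simp only: reflection_def)
  also have "\<dots> = X + (2 * of_real ?s * w - (p - X))"
    by (simp add: scaleR_conv_of_real algebra_simps)
  also have "2 * of_real ?s * w - (p - X) = w\<^sup>2 * cnj (p - X)"
  proof -
    define q where "q = p - X"
    have cw: "cnj w * w = 1" using assms complex_norm_square[of w] by (simp add: mult.commute)
    have "2 * of_real (q \<bullet> w) = q * cnj w + cnj q * w"
      by (simp add: complex_eq_iff inner_complex_def algebra_simps)
    then have "2 * of_real (q \<bullet> w) * w = q * (cnj w * w) + cnj q * w\<^sup>2"
      by (simp add: algebra_simps power2_eq_square)
    then show ?thesis using cw unfolding q_def by (simp add: algebra_simps)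
  qed
  finally show ?thesis .
qed

lemma range_line_eq_iff:
  fixes X u v :: complex
  assumes "u \<noteq> 0" "v \<noteq> 0"
  shows "range (\<lambda>t. X + of_real t * u) = range (\<lambda>t. X + of_real t * v) \<longleftrightarrow> u * cnj v \<in> \<real>"
proof
  assume eq: "range (\<lambda>t. X + of_real t * u) = range (\<lambda>t. X + of_real t * v)"
  have "X + of_real 1 * u \<in> range (\<lambda>t. X + of_real t * u)" by blast
  then obtain t where "X + of_real 1 * u = X + of_real t * v" unfolding eq by blast
  then have "u = of_real t * v" by simp
  then show "u * cnj v \<in> \<real>" by (simp add: mult.assoc complex_mult_cnj)
next
  assume "u * cnj v \<in> \<real>"
  then obtain r where r: "u * cnj v = of_real r" by (auto elim: Reals_cases)
  define k where "k = r / (norm v)\<^sup>2"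
  have "u * (cnj v * v) = of_real r * v" using r by (metis mult.assoc)
  moreover have "cnj v * v = of_real ((norm v)\<^sup>2)"
    using complex_norm_square[of v] by (simp add: mult.commute)
  ultimately have "u * of_real ((norm v)\<^sup>2) = of_real r * v" by (simp only:)
  then have u: "u = of_real k * v" using assms by (simp add: k_def field_simps)
  then have k: "k \<noteq> 0" using assms by auto
  show "range (\<lambda>t. X + of_real t * u) = range (\<lambda>t. X + of_real t * v)"
  proof (intro equalityI subsetI)
    fix y assume "y \<in> range (\<lambda>t. X + of_real t * u)"
    then obtain t where "y = X + of_real t * u" by blast
    then have "y = X + of_real (t * k) * v" by (simp add: u)
    then show "y \<in> range (\<lambda>t. X + of_real t * v)" by blast
  next
    fix y assume "y \<in> range (\<lambda>t. X + of_real t * v)"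
    then obtain t where "y = X + of_real t * v" by auto
    then have "y = X + of_real (t / k) * u" using k by (simp add: u)
    then show "y \<in> range (\<lambda>t. X + of_real t * u)" by blast
  qed
qed

lemma angle_bisectors_eq:
  assumes "P \<noteq> X" "Q \<noteq> X"
  shows "angle_bisectors X (affine hull {X, P}) (affine hull {X, Q}) =
    {range (\<lambda>t. X + of_real t * w) | w. norm w = 1 \<and> w\<^sup>2 * cnj ((X - P) * (X - Q)) \<in> \<real>}"
proof -
  have *: "reflection (range (\<lambda>t. X + of_real t * w)) ` (affine hull {X, P}) = affine hull {X, Q}
      \<longleftrightarrow> w\<^sup>2 * cnj ((X - P) * (X - Q)) \<in> \<real>" if w: "norm w = 1" for w
  proof -
    have "w \<noteq> 0" using w by auto
    have "reflection (range (\<lambda>t. X + of_real t * w)) ` (affine hull {X, P})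
        = range (\<lambda>t. X + of_real t * (w\<^sup>2 * cnj (P - X)))"
      unfolding affine_hull_2_alt image_image reflection_line[OF w]
      by (simp add: scaleR_conv_of_real mult_ac)
    moreover have "affine hull {X, Q} = range (\<lambda>t. X + of_real t * (Q - X))"
      by (simp add: affine_hull_2_alt scaleR_conv_of_real)
    moreover have "range (\<lambda>t. X + of_real t * (w\<^sup>2 * cnj (P - X))) = range (\<lambda>t. X + of_real t * (Q - X))
        \<longleftrightarrow> (w\<^sup>2 * cnj (P - X)) * cnj (Q - X) \<in> \<real>"
      using assms \<open>w \<noteq> 0\<close> by (intro range_line_eq_iff) auto
    moreover have "(w\<^sup>2 * cnj (P - X)) * cnj (Q - X) = w\<^sup>2 * cnj ((X - P) * (X - Q))"
      by (simp add: algebra_simps)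
    ultimately show ?thesis by (simp only:)
  qed
  show ?thesis
  proof (intro equalityI subsetI)
    fix n assume "n \<in> angle_bisectors X (affine hull {X, P}) (affine hull {X, Q})"
    then obtain R where R: "R \<noteq> X" "n = affine hull {X, R}"
      and r: "reflection n ` (affine hull {X, P}) = affine hull {X, Q}"
      by (auto simp: angle_bisectors_def)
    from R(1) obtain w where w: "norm w = 1" "affine hull {X, R} = range (\<lambda>t. X + of_real t * w)"
      by (rule line_unit)
    with R r * show "n \<in> {range (\<lambda>t. X + of_real t * w) | w. norm w = 1 \<and> w\<^sup>2 * cnj ((X - P) * (X - Q)) \<in> \<real>}"
      by auto
  next
    fix n assume "n \<in> {range (\<lambda>t. X + of_real t * w) | w. norm w = 1 \<and> w\<^sup>2 * cnj ((X - P) * (X - Q)) \<in> \<real>}"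
    then obtain w where w: "norm w = 1" "w\<^sup>2 * cnj ((X - P) * (X - Q)) \<in> \<real>"
      "n = range (\<lambda>t. X + of_real t * w)" by auto
    then have "w \<noteq> 0" by auto
    then have "X + w \<noteq> X \<and> n = affine hull {X, X + w}"
      using w by (simp add: affine_hull_2_alt scaleR_conv_of_real)
    with w * show "n \<in> angle_bisectors X (affine hull {X, P}) (affine hull {X, Q})"
      unfolding angle_bisectors_def by blast
  qed
qed

lemma isogonal_iff:
  assumes "X \<notin> {A, B, C, D}"
  shows "isogonal X A B C D \<longleftrightarrow> (X - B) * (X - D) * cnj ((X - A) * (X - C)) \<in> \<real>"
proof -
  define s where "s = (X - A) * (X - C)"
  define s' where "s' = (X - B) * (X - D)"
  have nz: "s \<noteq> 0" "s' \<noteq> 0" using assms by (auto simp: s_def s'_def)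
  let ?S = "\<lambda>s. {range (\<lambda>t. X + of_real t * w) | w. norm w = 1 \<and> w\<^sup>2 * cnj s \<in> \<real>}"
  have iso: "isogonal X A B C D \<longleftrightarrow> ?S s = ?S s'"
    using assms unfolding isogonal_def s_def s'_def
    by (subst (1 2) angle_bisectors_eq) auto
  have mono: "w\<^sup>2 * cnj a \<in> \<real>" if "w\<^sup>2 * cnj b \<in> \<real>" "b * cnj a \<in> \<real>" "b \<noteq> 0" for w a b :: complex
  proof -
    have "(w\<^sup>2 * cnj b) * (b * cnj a) / of_real ((norm b)\<^sup>2) \<in> \<real>"
      by (rule Reals_divide[OF Reals_mult[OF that(1,2)] Reals_of_real])
    moreover have "(w\<^sup>2 * cnj b) * (b * cnj a) / of_real ((norm b)\<^sup>2) = w\<^sup>2 * cnj a"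
      using that complex_norm_square[of b] by (simp add: field_simps)
    ultimately show ?thesis by simp
  qed
  have "?S s = ?S s' \<longleftrightarrow> s' * cnj s \<in> \<real>"
  proof
    assume eq: "?S s = ?S s'"
    define w where "w = csqrt s / of_real (norm (csqrt s))"
    have w1: "norm w = 1" using nz by (simp add: w_def norm_divide)
    then have w0: "w \<noteq> 0" by auto
    have w2: "w\<^sup>2 = s / of_real (norm s)"
      using nz by (simp add: w_def power_divide flip: of_real_power norm_power)
    have "w\<^sup>2 * cnj s = of_real (norm s)"
    proof -
      have "w\<^sup>2 * cnj s = s * cnj s / of_real (norm s)" by (simp add: w2)
      also have "\<dots> = of_real ((norm s)\<^sup>2 / norm s)"
        by (simp only: complex_norm_square[symmetric] of_real_divide)
      finally show ?thesis using nz by (simp add: power2_eq_square)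
    qed
    then have "w\<^sup>2 * cnj s \<in> \<real>" by simp
    with w1 have "range (\<lambda>t. X + of_real t * w) \<in> ?S s" by blast
    then obtain v where v: "norm v = 1" "v\<^sup>2 * cnj s' \<in> \<real>"
      "range (\<lambda>t. X + of_real t * w) = range (\<lambda>t. X + of_real t * v)"
      unfolding eq by auto
    then have "v \<noteq> 0" by auto
    with v w0 have "w * cnj v \<in> \<real>" by (simp add: range_line_eq_iff)
    then have "(w * cnj v)\<^sup>2 * (v\<^sup>2 * cnj s') \<in> \<real>" by (rule Reals_mult[OF Reals_power v(2)])
    moreover have "(w * cnj v)\<^sup>2 * (v\<^sup>2 * cnj s') = (v * cnj v)\<^sup>2 * (w\<^sup>2 * cnj s')"
      by (simp add: power_mult_distrib mult_ac)
    moreover have "v * cnj v = 1" using v complex_norm_square[of v] by simp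
    ultimately have "w\<^sup>2 * cnj s' \<in> \<real>" by simp
    then have "of_real (norm s) * (w\<^sup>2 * cnj s') \<in> \<real>" by (rule Reals_mult[OF Reals_of_real])
    then have "s * cnj s' \<in> \<real>" using nz by (simp add: w2)
    then have "cnj (s * cnj s') \<in> \<real>" by (metis Reals_cnj_iff)
    then show "s' * cnj s \<in> \<real>" by (simp add: mult.commute)
  next
    assume r: "s' * cnj s \<in> \<real>"
    then have "cnj (s' * cnj s) \<in> \<real>" by (metis Reals_cnj_iff)
    then have "s * cnj s' \<in> \<real>" by (simp add: mult.commute)
    with r mono nz have "w\<^sup>2 * cnj s \<in> \<real> \<longleftrightarrow> w\<^sup>2 * cnj s' \<in> \<real>" for w by blast
    then show "?S s = ?S s'" by simp
  qed
  with iso show ?thesis by (simp add: s_def s'_def)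
qed

lemma isogonal_cubic_eq:
  "isogonal_cubic a b c d =
     {x. (x - b) * (x - d) * cnj ((x - a) * (x - c)) = cnj ((x - b) * (x - d)) * ((x - a) * (x - c))}"
proof -
  have "x \<in> isogonal_cubic a b c d \<longleftrightarrow>
    (x - b) * (x - d) * cnj ((x - a) * (x - c)) = cnj ((x - b) * (x - d)) * ((x - a) * (x - c))" for x
  proof (cases "x \<in> {a, b, c, d}")
    case True
    then show ?thesis by (auto simp: isogonal_cubic_def)
  next
    case False
    then have "x \<in> isogonal_cubic a b c d \<longleftrightarrow> (x - b) * (x - d) * cnj ((x - a) * (x - c)) \<in> \<real>"
      by (simp only: isogonal_cubic_def isogonal_iff mem_Collect_eq simp_thms)
    also have "\<dots> \<longleftrightarrow> cnj ((x - b) * (x - d) * cnj ((x - a) * (x - c))) = (x - b) * (x - d) * cnj ((x - a) * (x - c))"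
      by (simp only: Reals_cnj_iff)
    also have "cnj ((x - b) * (x - d) * cnj ((x - a) * (x - c))) = cnj ((x - b) * (x - d)) * ((x - a) * (x - c))"
      by (simp only: complex_cnj_mult complex_cnj_cnj)
    finally show ?thesis by metis
  qed
  then show ?thesis by blast
qed

end

theory Submission
  imports Defs "HOL-Computational_Algebra.Polynomial_Factorial" "HOL-Computational_Algebra.Field_as_Ring"
begin

text \<open>
  If the circular points lie on the cubic and their tangents meet at a point \<open>p\<close> of it, then \<open>p\<close> is
  real, and in the coordinate \<open>w = x - p\<close> the equation takes the form
  \<open>Re ((l w\<^sup>2 + n w + k) cnj w) = 0\<close> with \<open>n\<close> real, \<open>l \<noteq> 0\<close>, and \<open>k \<noteq> 0\<close> by irreducibility. Thus the
  cubic is the preimage of the line \<open>Re = - n\<close> under the map \<open>w \<mapsto> l w + k / w\<close> of degree 2. If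
  \<open>{a, c}\<close> and \<open>{b, d}\<close> are the fibres over two points \<open>t\<^sub>1\<close>, \<open>t\<^sub>2\<close> of that line, then
  \<open>(w - a) (w - c) / ((w - b) (w - d))\<close> is real iff \<open>l w + k / w\<close> lies on the line through \<open>t\<^sub>1\<close>
  and \<open>t\<^sub>2\<close>, which is the isogonality of \<open>(wa, wc)\<close> and \<open>(wb, wd)\<close>.

  Conversely, the isogonal cubic has infinitely many points: \<open>(x - b) (x - d) = r (x - a) (x - c)\<close>
  is solvable for every real \<open>r \<noteq> 1\<close>. Hence an irreducible \<open>F\<close> with the same real points divides the
  isogonal equation and, by degrees, agrees with it up to a constant factor. For that equation the
  tangents at the circular points meet at \<open>p = (ac - bd) / (a + c - b - d)\<close>, which satisfies
  \<open>(p - a) (p - c) = (p - b) (p - d)\<close> and hence lies on the cubic.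
\<close>

section \<open>Finiteness of the common zeros of two plane curves\<close>

text \<open>Elimination of y: \<open>d\<close>, a polynomial in x alone, vanishes at the abscissa of
  every common zero of \<open>F\<close> and \<open>G\<close>.\<close>

lemma prime_elem_bezout_coeff:
  fixes F G :: "real poly poly"
  assumes F: "prime_elem F" "degree F > 0" and G: "\<not> F dvd G"
  obtains a b d where "d \<noteq> 0" "a * F + b * G = [:d:]"
proof -
  \<comment> \<open>An element of minimal degree of the ideal generated by \<open>F\<close> and \<open>G\<close> divides both up to factors
    in \<open>\<real>[x]\<close>; as \<open>F\<close> is prime, its degree is 0.\<close>
  define S where "S = {H. H \<noteq> 0 \<and> (\<exists>a b. H = a * F + b * G)}"
  have "F \<noteq> 0" using F by auto
  then have "F \<in> S" unfolding S_def by simp (metis add_0_right mult_1 mult_zero_left)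
  then obtain H where H: "H \<in> S" and min: "\<And>K. K \<in> S \<Longrightarrow> degree H \<le> degree K"
    using exists_least_iff[of "\<lambda>n. \<exists>K\<in>S. degree K = n"] by (metis linorder_not_less)
  then obtain a b where ab: "H = a * F + b * G" and "H \<noteq> 0" by (auto simp: S_def)
  have pseudo_dvd: "\<exists>c q. c \<noteq> 0 \<and> smult c K = q * H" if K: "K = e * F + f * G" for K e f
  proof -
    obtain q r where qr: "pseudo_divmod K H = (q, r)" by (cases "pseudo_divmod K H")
    define c where "c = lead_coeff H ^ (Suc (degree K) - degree H)"
    from pseudo_divmod[OF \<open>H \<noteq> 0\<close> qr] have
      r: "smult c K = H * q + r" "r = 0 \<or> degree r < degree H" by (auto simp: c_def)
    have "r = (smult c e - q * a) * F + (smult c f - q * b) * G"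
      using r(1) unfolding K ab by (simp add: algebra_simps smult_add_right)
    then have "r \<in> S \<or> r = 0" unfolding S_def by blast
    with min r(2) have "r = 0" by fastforce
    with r have "smult c K = q * H" by (simp add: mult.commute)
    moreover have "c \<noteq> 0" using \<open>H \<noteq> 0\<close> by (simp add: c_def)
    ultimately show ?thesis by blast
  qed
  have "degree H = 0"
  proof (rule ccontr)
    assume "degree H \<noteq> 0"
    obtain c q where c: "c \<noteq> 0" "smult c F = q * H" using pseudo_dvd[of F 1 0] by auto
    obtain c' q' where c': "c' \<noteq> 0" "smult c' G = q' * H" using pseudo_dvd[of G 0 1] by auto
    have "F dvd q * H" using c(2) by (metis dvd_refl dvd_smult)
    \<comment> \<open>If \<open>F\<close> divides \<open>q\<close>, cancelling it makes
      \<open>H\<close> a divisor of \<open>[:c:]\<close>, which has degree 0 in y; if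
      \<open>F\<close> divides \<open>H\<close>, it divides \<open>[:c':]\<close>, again of degree
      0.\<close>
    with F(1) consider "F dvd q" | "F dvd H" using prime_elem_dvd_multD by blast
    then show False
    proof cases
      case 1
      then obtain e where "q = F * e" by (elim dvdE)
      with c(2) have "F * [:c:] = F * (e * H)" by (simp add: mult.assoc)
      with \<open>F \<noteq> 0\<close> have "[:c:] = e * H" using mult_left_cancel by blast
      moreover from this c(1) have "e \<noteq> 0" by auto
      ultimately have "degree [:c:] = degree e + degree H"
        using \<open>H \<noteq> 0\<close> degree_mult_eq[of e H] by metis
      with \<open>degree H \<noteq> 0\<close> show False by simp
    next
      case 2
      then have "F dvd [:c':] * G" using c'(2) by simp
      with F(1) G have "F dvd [:c':]" using prime_elem_dvd_multD by blast
      with c'(1) have "degree F \<le> degree [:c':]" by (intro dvd_imp_degree_le) auto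
      with F(2) show False by simp
    qed
  qed
  then obtain d where "H = [:d:]" by (elim degree_eq_zeroE)
  with ab \<open>H \<noteq> 0\<close> show ?thesis by (intro that[of d a b]) auto
qed

text \<open>The cofactor must be a unit, so \<open>F\<close> is a constant multiple of the linear
  factor. Hence an irreducible cubic contains no vertical line.\<close>

lemma irreducible_linear_factor_total_degree:
  fixes F :: "real poly poly"
  assumes "irreducible F" "[:[:- x, 1:]:] dvd F"
  shows "total_degree F \<le> 1"
proof -
  from assms(2) obtain K where K: "F = [:[:- x, 1:]:] * K" by (elim dvdE)
  have "\<not> [:[:- x, 1:]:] dvd (1 :: real poly poly)" by (auto simp: is_unit_poly_iff)
  with assms(1) K have "K dvd 1" using irreducibleD by blast
  then obtain k where k: "K = [:[:k:]:]" by (auto simp: is_unit_poly_iff)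
  have "coeff (coeff F j) i = 0" if "i + j > 1" for i j
    using that unfolding K k by (cases j; cases i rule: nat.exhaust)
      (auto simp: coeff_pCons split: nat.splits)
  then have "{i + j | i j. coeff (coeff F j) i \<noteq> 0} \<subseteq> {..1}" by (force simp: not_less)
  moreover from this have "finite {i + j | i j. coeff (coeff F j) i \<noteq> 0}"
    by (rule finite_subset) simp
  ultimately show ?thesis unfolding total_degree_def by (subst Max_le_iff) auto
qed

lemma poly_poly_eq_0_imp_linear_dvd:
  fixes F :: "real poly poly"
  assumes "\<And>j. poly (coeff F j) x = 0"
  shows "[:[:- x, 1:]:] dvd F"
  using assms by (simp add: const_poly_dvd_iff poly_eq_0_iff_dvd)

text \<open>A weak form of Bezout's theorem: elimination leaves finitely many abscissae, and a
  vertical line, not being a component of \<open>F\<close>, meets the curve in finitely many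
  points.\<close>

lemma plane_curve_inter_finite:
  assumes F: "irreducible F" "total_degree F > 1" and G: "\<not> F dvd G"
  shows "finite (plane_curve F \<inter> plane_curve G)"
proof (cases "degree F = 0")
  case True
  then obtain f where f: "F = [:f:]" by (elim degree_eq_zeroE)
  \<comment> \<open>Here \<open>F\<close> depends on x only, so a real point on the curve would
    yield a vertical line as a factor.\<close>
  have "plane_curve F = {}"
  proof (rule ccontr)
    assume "plane_curve F \<noteq> {}"
    then obtain p where "poly f (Re p) = 0" by (auto simp: f plane_curve_def)
    then have "poly (coeff F j) (Re p) = 0" for j
      by (simp add: f coeff_pCons split: nat.split)
    with F irreducible_linear_factor_total_degree poly_poly_eq_0_imp_linear_dvd
    show False by (metis linorder_not_less)
  qed
  then show ?thesis by simp
next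
  case False
  then have deg: "degree F > 0" by simp
  have "prime_elem F" using F(1) by (simp add: irreducible_imp_prime_elem)
  then obtain a b d where d: "d \<noteq> 0" "a * F + b * G = [:d:]"
    using deg G by (rule prime_elem_bezout_coeff)
  define X where "X = {x. poly d x = 0}"
  \<comment> \<open>\<open>f x\<close> is the restriction of \<open>F\<close> to the vertical line
    over \<open>x\<close>, a polynomial in y.\<close>
  define f where "f x = map_poly (\<lambda>q. poly q x) F" for x :: real
  have ev: "poly (f x) y = poly (poly F [:y:]) x" for x y
    unfolding f_def 
    by (induction F) (simp_all add: map_poly_pCons)
  have f0: "f x \<noteq> 0" for x
  proof
    assume "f x = 0"
    then have "coeff (f x) j = 0" for j by simp
    then have "poly (coeff F j) x = 0" for j by (simp add: f_def coeff_map_poly)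
    with F irreducible_linear_factor_total_degree poly_poly_eq_0_imp_linear_dvd
    show False by (metis linorder_not_less)
  qed
  have "finite X" unfolding X_def using d(1) by (rule poly_roots_finite)
  then have "finite (\<Union>x\<in>X. Complex x ` {y. poly (f x) y = 0})"
    using f0 by (intro finite_UN_I finite_imageI poly_roots_finite)
  moreover have "plane_curve F \<inter> plane_curve G \<subseteq> (\<Union>x\<in>X. Complex x ` {y. poly (f x) y = 0})"
  proof
    fix p assume p: "p \<in> plane_curve F \<inter> plane_curve G"
    then have "poly (poly (a * F + b * G) [:Im p:]) (Re p) = 0"
      by (simp add: plane_curve_def)
    then have "Re p \<in> X" unfolding d(2) X_def by simp
    moreover have "poly (f (Re p)) (Im p) = 0" using p by (simp add: ev plane_curve_def)
    ultimately show "p \<in> (\<Union>x\<in>X. Complex x ` {y. poly (f x) y = 0})"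
      by (intro UN_I[of "Re p"] image_eqI[of _ _ "Im p"]) auto
  qed
  ultimately show ?thesis by (rule finite_subset[rotated])
qed

section \<open>Total degree and divisibility\<close>

text \<open>Maximality of \<open>j\<close> singles out one leading monomial among those of top
  degree, so that in a product the leading terms cannot cancel.\<close>

lemma total_degree_attained:
  assumes "F \<noteq> 0"
  obtains i j where "coeff (coeff F j) i \<noteq> 0" "i + j = total_degree F"
    "\<forall>i' j'. coeff (coeff F j') i' \<noteq> 0 \<longrightarrow> i' + j' = total_degree F \<longrightarrow> j' \<le> j"
proof -
  let ?T = "{i + j | i j. coeff (coeff F j) i \<noteq> 0}"
  have fin: "finite ?T" by (rule finite_subset[of _ "{..total_degree F}"]) (auto dest: le_total_degree)
  have "coeff (coeff F (degree F)) (degree (coeff F (degree F))) \<noteq> 0" using assms by simp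
  then have ne: "?T \<noteq> {}" by blast
  have "total_degree F = Max ?T" unfolding total_degree_def using fin ne by simp
  also have "\<dots> \<in> ?T" by (rule Max_in[OF fin ne])
  finally obtain i j where ij: "coeff (coeff F j) i \<noteq> 0" "i + j = total_degree F"
    unfolding mem_Collect_eq by metis
  define J where "J = {j. \<exists>i. coeff (coeff F j) i \<noteq> 0 \<and> i + j = total_degree F}"
  have J: "finite J" "J \<noteq> {}" using ij
    by (auto simp: J_def intro: finite_subset[of _ "{..total_degree F}"])
  from Max_in[OF J] obtain i0 where "coeff (coeff F (Max J)) i0 \<noteq> 0" "i0 + Max J = total_degree F"
    by (auto simp: J_def)
  then show ?thesis using J by (intro that) (auto simp: J_def intro: Max_ge)
qed

lemma total_degree_mult_ge:
  fixes F K :: "real poly poly"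
  assumes "F \<noteq> 0" "K \<noteq> 0"
  shows "total_degree F + total_degree K \<le> total_degree (F * K)"
proof -
  \<comment> \<open>Only the product of the lexicographically leading monomials of top degree contributes to
    the coefficient considered.\<close>
  obtain i1 j1 where 1: "coeff (coeff F j1) i1 \<noteq> 0" "i1 + j1 = total_degree F"
    "\<forall>i j. coeff (coeff F j) i \<noteq> 0 \<longrightarrow> i + j = total_degree F \<longrightarrow> j \<le> j1"
    using total_degree_attained[OF assms(1)] by metis
  obtain i2 j2 where 2: "coeff (coeff K j2) i2 \<noteq> 0" "i2 + j2 = total_degree K"
    "\<forall>i j. coeff (coeff K j) i \<noteq> 0 \<longrightarrow> i + j = total_degree K \<longrightarrow> j \<le> j2"
    using total_degree_attained[OF assms(2)] by metis
  have zero: "coeff (coeff F j) i * coeff (coeff K (j1 + j2 - j)) (i1 + i2 - i) = 0"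
    if "j \<le> j1 + j2" "i \<le> i1 + i2" "(j, i) \<noteq> (j1, i1)" for i j
  proof (rule ccontr)
    assume "\<not> ?thesis"
    then have nz: "coeff (coeff F j) i \<noteq> 0" "coeff (coeff K (j1 + j2 - j)) (i1 + i2 - i) \<noteq> 0" by auto
    \<comment> \<open>The two degrees add up to \<open>total_degree F + total_degree K\<close>, so
      both bounds are attained; maximality of \<open>j1\<close> and \<open>j2\<close> then forces
      \<open>j = j1\<close> and \<open>i = i1\<close>.\<close>
    from le_total_degree[OF nz(1)] le_total_degree[OF nz(2)] that 1(2) 2(2)
    have "i + j = total_degree F" "(i1 + i2 - i) + (j1 + j2 - j) = total_degree K" by linarith+
    with 1(2,3) 2(3) nz that show False by fastforce
  qed
  have "coeff (coeff (F * K) (j1 + j2)) (i1 + i2) =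
      (\<Sum>j\<le>j1 + j2. \<Sum>i\<le>i1 + i2. coeff (coeff F j) i * coeff (coeff K (j1 + j2 - j)) (i1 + i2 - i))"
    by (simp add: coeff_mult coeff_sum)
  also have "\<dots> = (\<Sum>(j, i)\<in>{..j1 + j2} \<times> {..i1 + i2}.
      coeff (coeff F j) i * coeff (coeff K (j1 + j2 - j)) (i1 + i2 - i))"
    by (simp add: sum.cartesian_product)
  also have "\<dots> = (\<Sum>(j, i)\<in>{(j1, i1)}.
      coeff (coeff F j) i * coeff (coeff K (j1 + j2 - j)) (i1 + i2 - i))"
  proof (intro sum.mono_neutral_right ballI)
    fix x assume "x \<in> {..j1 + j2} \<times> {..i1 + i2} - {(j1, i1)}"
    then show "(case x of (j, i) \<Rightarrow>
        coeff (coeff F j) i * coeff (coeff K (j1 + j2 - j)) (i1 + i2 - i)) = 0"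
      using zero[of "fst x" "snd x"] by (cases x) simp
  qed auto
  also have "\<dots> \<noteq> 0" using 1 2 by simp
  finally show ?thesis using 1(2) 2(2) by (auto dest: le_total_degree)
qed

text \<open>The total degree of a product is at least the sum of those of its factors, so the
  cofactor has total degree 0 and is a real constant.\<close>

lemma dvd_total_degree_le_imp_smult:
  fixes F G :: "real poly poly"
  assumes "F dvd G" "G \<noteq> 0" "total_degree G \<le> total_degree F"
  obtains k where "k \<noteq> 0" "G = smult [:k:] F"
proof -
  from assms(1) obtain K where K: "G = F * K" by (elim dvdE)
  with assms(2) have "F \<noteq> 0" "K \<noteq> 0" by auto
  with assms(3) total_degree_mult_ge[of F K] K have K0: "total_degree K = 0" by simp
  have "coeff (coeff K j) i = coeff (coeff [:[:coeff (coeff K 0) 0:]:] j) i" for i j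
    using le_total_degree[of K j i] K0 by (auto simp: coeff_pCons split: nat.splits)
  then have "K = [:[:coeff (coeff K 0) 0:]:]" by (intro poly_eqI)
  then obtain k where k: "K = [:[:k:]:]" by metis
  have "G = smult [:k:] F" unfolding K k by simp
  moreover have "k \<noteq> 0" using \<open>K \<noteq> 0\<close> k by auto
  ultimately show ?thesis using that by blast
qed

section \<open>Cubics in terms of their ten coefficients\<close>

text \<open>\<open>c i j\<close> belongs to x^i y^j, whereas \<open>coeff (coeff F j) i\<close>
  takes the indices in the other order. Values of \<open>c\<close> with \<open>i + j > 3\<close> are
  ignored.\<close>

definition cubic_poly :: "(nat \<Rightarrow> nat \<Rightarrow> real) \<Rightarrow> real poly poly" where
  "cubic_poly c = [:[:c 0 0, c 1 0, c 2 0, c 3 0:], [:c 0 1, c 1 1, c 2 1:], [:c 0 2, c 1 2:], [:c 0 3:]:]"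

lemma coeff_cubic_poly:
  "coeff (coeff (cubic_poly c) j) i = (if i + j \<le> 3 then c i j else 0)"
proof (cases "i + j \<le> 3")
  case True
  then have "j = 0 \<or> j = 1 \<or> j = 2 \<or> j = 3" "i = 0 \<or> i = 1 \<or> i = 2 \<or> i = 3" by auto
  with True show ?thesis by (auto simp: cubic_poly_def numeral_2_eq_2 numeral_3_eq_3)
next
  case False
  then show ?thesis by (auto simp: cubic_poly_def coeff_pCons split: nat.splits)
qed

lemma total_degree_cubic_poly_le: "total_degree (cubic_poly c) \<le> 3"
proof (cases "cubic_poly c = 0")
  case True
  then show ?thesis by (simp add: total_degree_def)
next
  case False
  then obtain i j where "coeff (coeff (cubic_poly c) j) i \<noteq> 0" "i + j = total_degree (cubic_poly c)"
    by (rule total_degree_attained)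
  then show ?thesis by (auto simp: coeff_cubic_poly split: if_splits)
qed

lemma cubic_poly_coeffs:
  assumes "total_degree F \<le> 3"
  shows "F = cubic_poly (\<lambda>i j. coeff (coeff F j) i)"
proof (intro poly_eqI)
  fix i j show "coeff (coeff F j) i = coeff (coeff (cubic_poly (\<lambda>i j. coeff (coeff F j) i)) j) i"
    using assms le_total_degree[of F j i] by (cases "coeff (coeff F j) i = 0") (auto simp: coeff_cubic_poly)
qed

lemma poly_cubic_poly:
  "poly (poly (cubic_poly c) [:y:]) x =
    c 3 0 * x ^ 3 + c 2 1 * x ^ 2 * y + c 1 2 * x * y ^ 2 + c 0 3 * y ^ 3
    + c 2 0 * x ^ 2 + c 1 1 * x * y + c 0 2 * y ^ 2 + c 1 0 * x + c 0 1 * y + c 0 0"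
  by (simp add: cubic_poly_def algebra_simps power2_eq_square power3_eq_cube)

text \<open>The exact total degree enters through the exponent of \<open>v$3\<close>. The sums over
  the actual degrees are extended to 0, ..., 3 by terms with zero coefficient.\<close>

lemma homogenization_cubic_poly:
  assumes "total_degree (cubic_poly c) = 3"
  shows "homogenization (cubic_poly c) v =
    c 3 0 * (v$1) ^ 3 + c 2 1 * (v$1) ^ 2 * v$2 + c 1 2 * v$1 * (v$2) ^ 2 + c 0 3 * (v$2) ^ 3
    + (c 2 0 * (v$1) ^ 2 + c 1 1 * v$1 * v$2 + c 0 2 * (v$2) ^ 2) * v$3
    + (c 1 0 * v$1 + c 0 1 * v$2) * (v$3) ^ 2 + c 0 0 * (v$3) ^ 3"
proof -
  let ?F = "cubic_poly c"
  let ?t = "\<lambda>j i. of_real (coeff (coeff ?F j) i) * (v $ 1) ^ i * (v $ 2) ^ j * (v $ 3) ^ (3 - i - j)"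
  have zero: "coeff (coeff ?F j) i = 0" if "i > 3 \<or> j > 3" for i j
    using that by (auto simp: coeff_cubic_poly)
  have "degree ?F \<le> 3" by (rule degree_le) (auto simp: poly_eq_iff zero)
  have "degree (coeff ?F j) \<le> 3" for j by (rule degree_le) (auto simp: zero)
  then have "(\<Sum>i\<le>degree (coeff ?F j). ?t j i) = (\<Sum>i\<le>3. ?t j i)" for j
    by (intro sum.mono_neutral_left) (auto simp: coeff_eq_0)
  then have "homogenization ?F v = (\<Sum>j\<le>degree ?F. \<Sum>i\<le>3. ?t j i)"
    unfolding homogenization_def assms by (simp only:)
  also have "\<dots> = (\<Sum>j\<le>3. \<Sum>i\<le>3. ?t j i)"
    using \<open>degree ?F \<le> 3\<close> by (intro sum.mono_neutral_left) (auto simp: coeff_eq_0)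
  also have "\<dots> = c 3 0 * (v$1) ^ 3 + c 2 1 * (v$1) ^ 2 * v$2 + c 1 2 * v$1 * (v$2) ^ 2 + c 0 3 * (v$2) ^ 3
    + (c 2 0 * (v$1) ^ 2 + c 1 1 * v$1 * v$2 + c 0 2 * (v$2) ^ 2) * v$3
    + (c 1 0 * v$1 + c 0 1 * v$2) * (v$3) ^ 2 + c 0 0 * (v$3) ^ 3"
    by (simp add: coeff_cubic_poly numeral_3_eq_3 numeral_2_eq_2 algebra_simps)
  finally show ?thesis .
qed

lemma partial_deriv_homogenization_cubic_poly:
  assumes "total_degree (cubic_poly c) = 3"
  shows "partial_deriv 1 (homogenization (cubic_poly c)) v =
      3 * c 3 0 * (v$1) ^ 2 + 2 * c 2 1 * v$1 * v$2 + c 1 2 * (v$2) ^ 2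
      + (2 * c 2 0 * v$1 + c 1 1 * v$2) * v$3 + c 1 0 * (v$3) ^ 2"
    and "partial_deriv 2 (homogenization (cubic_poly c)) v =
      c 2 1 * (v$1) ^ 2 + 2 * c 1 2 * v$1 * v$2 + 3 * c 0 3 * (v$2) ^ 2
      + (c 1 1 * v$1 + 2 * c 0 2 * v$2) * v$3 + c 0 1 * (v$3) ^ 2"
    and "partial_deriv 3 (homogenization (cubic_poly c)) v =
      c 2 0 * (v$1) ^ 2 + c 1 1 * v$1 * v$2 + c 0 2 * (v$2) ^ 2
      + 2 * (c 1 0 * v$1 + c 0 1 * v$2) * v$3 + 3 * c 0 0 * (v$3) ^ 2"
  unfolding partial_deriv_def homogenization_cubic_poly[OF assms]
  by (rule DERIV_imp_deriv, simp, (rule derivative_eq_intros refl)+,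
      simp add: algebra_simps power2_eq_square)+

section \<open>The circular points and their tangents in coordinates\<close>

text \<open>Passage from the quotient to homogeneous coordinates: points of \<open>cp2\<close> are
  represented exactly by the nonzero vectors.\<close>

lemma circular_points_condition_iff:
  "(circular_I \<in> proj_curve F \<and> circular_J \<in> proj_curve F \<and>
      (\<exists>P \<in> proj_curve F. P \<in> tangent_line F circular_I \<and> P \<in> tangent_line F circular_J)) \<longleftrightarrow>
   homogenization F (vector [1, \<i>, 0]) = 0 \<and> homogenization F (vector [1, - \<i>, 0]) = 0 \<and>
   (\<exists>v. v \<noteq> 0 \<and> homogenization F v = 0 \<and>
     (\<Sum>k\<in>UNIV. partial_deriv k (homogenization F) (vector [1, \<i>, 0]) * v $ k) = 0 \<and>
     (\<Sum>k\<in>UNIV. partial_deriv k (homogenization F) (vector [1, - \<i>, 0]) * v $ k) = 0)"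
proof -
  have proj_rel_refl: "proj_rel v v \<longleftrightarrow> v \<noteq> 0" for v
    by (auto simp: proj_rel_def intro!: exI[of _ 1])
  show ?thesis
    unfolding proj_curve_def tangent_line_def mem_Collect_eq Bex_def
    by transfer (simp add: Bex_def in_respects proj_rel_refl)
qed

lemma cubic_poly_leading_form_nonzero:
  assumes "total_degree (cubic_poly c) = 3"
  shows "c 3 0 \<noteq> 0 \<or> c 2 1 \<noteq> 0 \<or> c 1 2 \<noteq> 0 \<or> c 0 3 \<noteq> 0"
proof -
  have "cubic_poly c \<noteq> 0" using assms by (auto simp: total_degree_def)
  then obtain i j where ij: "coeff (coeff (cubic_poly c) j) i \<noteq> 0" "i + j = total_degree (cubic_poly c)"
    by (rule total_degree_attained)
  then have "c i j \<noteq> 0" "i + j = 3" using assms by (auto simp: coeff_cubic_poly)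
  moreover from this have "i = 0 \<and> j = 3 \<or> i = 1 \<and> j = 2 \<or> i = 2 \<and> j = 1 \<or> i = 3 \<and> j = 0" by auto
  ultimately show ?thesis by auto
qed

text \<open>The common point of the tangents at \<open>I\<close> and \<open>J\<close>, if these points lie on the cubic.\<close>

definition circular_focus :: "(nat \<Rightarrow> nat \<Rightarrow> real) \<Rightarrow> complex" where
  "circular_focus c = - Complex (c 2 0 - c 0 2) (c 1 1) / (2 * Complex (c 3 0) (c 0 3))"

text \<open>At I and J the form takes the values (c30 - c12) + i (c21 - c03) and its conjugate. If
  they vanish, the tangents are x + i y = p z and x - i y = \<open>cnj p\<close> z with p =
  \<open>circular_focus c\<close>, which meet exactly at the real point (Re p : Im p : 1).\<close>

lemma circular_points_condition_cubic_poly: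
  fixes c :: "nat \<Rightarrow> nat \<Rightarrow> real"
  defines "F \<equiv> cubic_poly c"
  assumes td: "total_degree F = 3"
  shows "(circular_I \<in> proj_curve F \<and> circular_J \<in> proj_curve F \<and>
      (\<exists>P \<in> proj_curve F. P \<in> tangent_line F circular_I \<and> P \<in> tangent_line F circular_J)) \<longleftrightarrow>
    c 3 0 = c 1 2 \<and> c 2 1 = c 0 3 \<and> circular_focus c \<in> plane_curve F"
proof -
  let ?I = "vector [1, \<i>, 0] :: complex ^ 3" and ?J = "vector [1, - \<i>, 0] :: complex ^ 3"
  define T where "T u v = (\<Sum>k\<in>UNIV. partial_deriv k (homogenization F) u * v $ k)" for u v :: "complex ^ 3"
  define m where "m = Complex (c 3 0) (c 0 3)"
  define e where "e = Complex (c 2 0 - c 0 2) (c 1 1)"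
  define p where "p = circular_focus c"
  note H = homogenization_cubic_poly[OF td[unfolded F_def], folded F_def]
  note D = partial_deriv_homogenization_cubic_poly[OF td[unfolded F_def], folded F_def]
  have I: "homogenization F ?I = 0 \<longleftrightarrow> c 3 0 = c 1 2 \<and> c 2 1 = c 0 3"
    by (auto simp: H complex_eq_iff power2_eq_square power3_eq_cube)
  have J: "homogenization F ?J = 0 \<longleftrightarrow> c 3 0 = c 1 2 \<and> c 2 1 = c 0 3"
    by (auto simp: H complex_eq_iff power2_eq_square power3_eq_cube)
  have main: "(\<exists>v. v \<noteq> 0 \<and> homogenization F v = 0 \<and> T ?I v = 0 \<and> T ?J v = 0) \<longleftrightarrow> p \<in> plane_curve F"
    if circ: "c 3 0 = c 1 2" "c 2 1 = c 0 3"
  proof -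
    have m0: "m \<noteq> 0"
      using cubic_poly_leading_form_nonzero[OF td[unfolded F_def]] circ
      by (auto simp: m_def complex_eq_iff)
    have p: "e = - (2 * m * p)" using m0 by (simp add: p_def circular_focus_def m_def e_def)
    have cm: "of_real (c 3 0) + \<i> * of_real (c 0 3) = m" "of_real (c 3 0) - \<i> * of_real (c 0 3) = cnj m"
      "of_real (c 2 0) - of_real (c 0 2) + \<i> * of_real (c 1 1) = e"
      "of_real (c 2 0) - of_real (c 0 2) - \<i> * of_real (c 1 1) = cnj e"
      by (simp_all add: m_def e_def complex_eq_iff)
    have TI: "T ?I v = 2 * m * (v$1 + \<i> * v$2) + e * v$3" for v
      unfolding T_def sum_3 D cm[symmetric]
      by (simp add: circ[symmetric] power2_eq_square algebra_simps del: One_nat_def)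
    have TJ: "T ?J v = 2 * cnj m * (v$1 - \<i> * v$2) + cnj e * v$3" for v
      unfolding T_def sum_3 D cm[symmetric]
      by (simp add: circ[symmetric] power2_eq_square algebra_simps del: One_nat_def)
    have TI': "T ?I v = 0 \<longleftrightarrow> v$1 + \<i> * v$2 = p * v$3" for v
    proof -
      have "T ?I v = 2 * m * (v$1 + \<i> * v$2 - p * v$3)" unfolding TI p by (simp add: algebra_simps)
      then show ?thesis using m0 by simp
    qed
    have TJ': "T ?J v = 0 \<longleftrightarrow> v$1 - \<i> * v$2 = cnj p * v$3" for v
    proof -
      have "T ?J v = 2 * cnj m * (v$1 - \<i> * v$2 - cnj p * v$3)" unfolding TJ p by (simp add: algebra_simps)
      then show ?thesis using m0 by simp
    qed
    let ?P = "vector [of_real (Re p), of_real (Im p), 1] :: complex ^ 3"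
    have "homogenization F ?P = of_real (poly (poly F [:Im p:]) (Re p))"
      unfolding H unfolding F_def poly_cubic_poly by (simp add: algebra_simps)
    then have HP: "homogenization F ?P = 0 \<longleftrightarrow> p \<in> plane_curve F"
      by (simp add: plane_curve_def)
    \<comment> \<open>Adding and subtracting the two tangent equations gives the first two
      coordinates.\<close>
    have P: "v = v$3 *s ?P" if "T ?I v = 0" "T ?J v = 0" for v
    proof -
      have v: "v$1 + \<i> * v$2 = p * v$3" "v$1 - \<i> * v$2 = cnj p * v$3" using that TI' TJ' by auto
      have "2 * v$1 = (p + cnj p) * v$3" using v by algebra
      then have 1: "v$1 = v$3 * of_real (Re p)" by (simp add: complex_add_cnj)
      have "2 * \<i> * v$2 = (p - cnj p) * v$3" using v by algebra
      then have "2 * \<i> * v$2 = 2 * \<i> * (v$3 * of_real (Im p))" by (simp add: complex_diff_cnj)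
      then have 2: "v$2 = v$3 * of_real (Im p)" by simp
      show ?thesis using 1 2 by (simp add: vec_eq_iff forall_3)
    qed
    show ?thesis
    proof
      assume "\<exists>v. v \<noteq> 0 \<and> homogenization F v = 0 \<and> T ?I v = 0 \<and> T ?J v = 0"
      then obtain v where v: "v \<noteq> 0" "homogenization F v = 0" "v = v$3 *s ?P" using P by blast
      have "v$3 \<noteq> 0"
      proof
        assume "v$3 = 0"
        with v(3) have "v = 0 *s ?P" by (simp only:)
        with v(1) show False by simp
      qed
      moreover have "(v$3) ^ total_degree F * homogenization F ?P = 0"
        using v(2,3) homogenization_scale[of F "v$3" ?P] by simp
      ultimately show "p \<in> plane_curve F" using HP by simp
    next
      assume "p \<in> plane_curve F"
      then have "homogenization F ?P = 0" using HP by simp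
      moreover have "?P \<noteq> 0" by (auto simp: vec_eq_iff forall_3)
      moreover have "T ?I ?P = 0" "T ?J ?P = 0" unfolding TI' TJ' by (simp_all add: complex_eq_iff)
      ultimately show "\<exists>v. v \<noteq> 0 \<and> homogenization F v = 0 \<and> T ?I v = 0 \<and> T ?J v = 0" by blast
    qed
  qed
  show ?thesis unfolding circular_points_condition_iff I J using main unfolding T_def p_def by blast
qed

section \<open>The equation of the isogonal cubic and the infinitude of its points\<close>

text \<open>
  The coefficients of \<open>Im ((x\<^sup>2 - t x + v) cnj (x\<^sup>2 - s x + u))\<close> in terms of \<open>Re x\<close>, \<open>Im x\<close>; only
  entries with \<open>i + j \<le> 3\<close> are meaningful.
\<close>

definition isogonal_coeffs :: "complex \<Rightarrow> complex \<Rightarrow> complex \<Rightarrow> complex \<Rightarrow> nat \<Rightarrow> nat \<Rightarrow> real" where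
  "isogonal_coeffs a b c d i j =
    (let s = a + c; u = a * c; t = b + d; v = b * d; n = Im (t * cnj s); k = s * cnj v - t * cnj u
     in [[Im (v * cnj u), Im k, Im (v - u) + n, Im (s - t)],
         [Re k, - 2 * Re (v - u), - Re (s - t)],
         [n - Im (v - u), Im (s - t)],
         [- Re (s - t)]] ! j ! i)"

text \<open>The quartic term \<open>x\<^sup>2 * cnj (x\<^sup>2)\<close> is real, so the imaginary
  part has degree at most 3 in \<open>Re x\<close> and \<open>Im x\<close>.\<close>

lemma poly_isogonal_coeffs:
  "poly (poly (cubic_poly (isogonal_coeffs a b c d)) [:Im x:]) (Re x) =
     Im ((x - b) * (x - d) * cnj ((x - a) * (x - c)))"
proof -
  define s u t v where "s = a + c" "u = a * c" "t = b + d" "v = b * d"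
  note suv = this
  have "(x - b) * (x - d) = x * x - t * x + v" "(x - a) * (x - c) = x * x - s * x + u"
    unfolding suv by (simp_all add: algebra_simps)
  then show ?thesis
    by (simp add: poly_cubic_poly isogonal_coeffs_def Let_def flip: suv)
      (simp add: power2_eq_square power3_eq_cube algebra_simps)
qed

lemma mult_cnj_eq_iff_Im: "z * cnj y = cnj z * y \<longleftrightarrow> Im (z * cnj y) = 0"
  by (auto simp: complex_eq_iff algebra_simps)

lemma plane_curve_isogonal_coeffs:
  "plane_curve (cubic_poly (isogonal_coeffs a b c d)) = isogonal_cubic a b c d"
  unfolding plane_curve_def poly_isogonal_coeffs isogonal_cubic_eq mult_cnj_eq_iff_Im ..

lemma infinite_isogonal_cubic:
  assumes "distinct [a, b, c, d]"
  shows "infinite (isogonal_cubic a b c d)"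
proof -
  \<comment> \<open>\<open>r > 1\<close> keeps the leading coefficient \<open>1 - r\<close> of this
    quadratic equation nonzero.\<close>
  have "\<exists>x. (x - b) * (x - d) = of_real r * ((x - a) * (x - c))" if "r > 1" for r :: real
  proof -
    define A where "A = complex_of_real (1 - r)"
    define B where "B = of_real r * (a + c) - (b + d)"
    define C where "C = b * d - of_real r * (a * c)"
    define x where "x = (csqrt (B\<^sup>2 - 4 * A * C) - B) / (2 * A)"
    have "A \<noteq> 0" using that by (simp add: A_def)
    then have "2 * A * x + B = csqrt (B\<^sup>2 - 4 * A * C)" by (simp add: x_def)
    then have "(2 * A * x + B)\<^sup>2 = B\<^sup>2 - 4 * A * C" by simp
    then have "4 * A * (A * x\<^sup>2 + B * x + C) = 0" by (simp add: algebra_simps power2_eq_square)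
    with \<open>A \<noteq> 0\<close> have "A * x\<^sup>2 + B * x + C = 0" by simp
    then have "(x - b) * (x - d) = of_real r * ((x - a) * (x - c))"
      by (simp add: A_def B_def C_def algebra_simps power2_eq_square)
    then show ?thesis ..
  qed
  then obtain f where f: "\<And>r. r > 1 \<Longrightarrow> (f r - b) * (f r - d) = of_real r * ((f r - a) * (f r - c))"
    by metis
  have "inj_on f {1<..}"
  proof (rule inj_onI)
    fix r r' :: real assume r: "r \<in> {1<..}" "r' \<in> {1<..}" "f r = f r'"
    then have "of_real r * ((f r - a) * (f r - c)) = of_real r' * ((f r - a) * (f r - c))"
      using f[of r] f[of r'] by (metis greaterThan_iff)
    \<comment> \<open>Otherwise \<open>(f r - b) * (f r - d)\<close> would vanish as well, putting
      \<open>f r\<close> in both {a, c} and {b, d}.\<close>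
    moreover have "(f r - a) * (f r - c) \<noteq> 0" using f[of r] r assms by auto
    ultimately have "complex_of_real r = of_real r'" using mult_right_cancel by blast
    then show "r = r'" by simp
  qed
  then have "infinite (f ` {1<..})" using finite_imageD infinite_Ioi by blast
  moreover have "f ` {1<..} \<subseteq> isogonal_cubic a b c d"
    unfolding isogonal_cubic_eq
  proof (intro image_subsetI CollectI)
    have real_ratio: "z * cnj y = cnj z * y" if "z = of_real r * y" for r y z
      by (simp add: that mult_ac)
    fix r :: real assume "r \<in> {1<..}"
    then show "(f r - b) * (f r - d) * cnj ((f r - a) * (f r - c)) =
        cnj ((f r - b) * (f r - d)) * ((f r - a) * (f r - c))"
      by (intro real_ratio[of _ r] f) simp
  qed
  ultimately show ?thesis using finite_subset by blast
qed

section \<open>From isogonality to the circular points\<close>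

lemma isogonal_imp_circular_points_condition:
  fixes F :: "real poly poly"
  assumes td: "total_degree F = 3" and irr: "irreducible F"
    and dist: "distinct [a, b, c, d]" and F: "plane_curve F = isogonal_cubic a b c d"
  shows "circular_I \<in> proj_curve F \<and> circular_J \<in> proj_curve F \<and>
      (\<exists>P \<in> proj_curve F. P \<in> tangent_line F circular_I \<and> P \<in> tangent_line F circular_J)"
proof -
  define s u t v where "s = a + c" "u = a * c" "t = b + d" "v = b * d"
  note suv = this
  define g where "g = isogonal_coeffs a b c d"
  define G where "G = cubic_poly g"
  have G: "plane_curve G = isogonal_cubic a b c d"
    unfolding G_def g_def by (rule plane_curve_isogonal_coeffs)
  have g: "g 3 0 = Im (s - t)" "g 1 2 = Im (s - t)" "g 2 1 = - Re (s - t)" "g 0 3 = - Re (s - t)"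
    "g 2 0 - g 0 2 = 2 * Im (v - u)" "g 1 1 = - 2 * Re (v - u)"
    by (simp_all add: g_def isogonal_coeffs_def suv Let_def numeral_2_eq_2 numeral_3_eq_3)
  have "F dvd G"
  proof (rule ccontr)
    assume "\<not> F dvd G"
    then have "finite (plane_curve F \<inter> plane_curve G)"
      using irr td by (intro plane_curve_inter_finite) auto
    with F G infinite_isogonal_cubic[OF dist] show False by simp
  qed
  \<comment> \<open>If all coefficients vanished, the quadratics (x - a)(x - c) and (x - b)(x - d)
    would coincide; evaluating at \<open>a\<close> contradicts distinctness.\<close>
  moreover have "G \<noteq> 0"
  proof
    assume "G = 0"
    then have g0: "g i j = 0" if "i + j \<le> 3" for i j
      using that coeff_cubic_poly[of g j i] by (simp add: G_def)
    have "s = t" using g(1,3) g0[of 3 0] g0[of 2 1] by (simp add: complex_eq_iff)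
    moreover have "v = u"
      using g(5,6) g0[of 2 0] g0[of 0 2] g0[of 1 1] by (simp add: complex_eq_iff)
    moreover have "(a - b) * (a - d) = (s - t) * a + (v - u)" by (simp add: suv algebra_simps)
    ultimately have "(a - b) * (a - d) = 0" by simp
    with dist show False by auto
  qed
  ultimately obtain k where k: "k \<noteq> 0" "G = smult [:k:] F"
    using total_degree_cubic_poly_le[of g] td unfolding G_def
    by (metis dvd_total_degree_le_imp_smult)
  define f where "f i j = g i j / k" for i j
  have "F = cubic_poly f"
  proof (intro poly_eqI)
    fix i j
    have "coeff (coeff G j) i = k * coeff (coeff F j) i" by (simp add: k(2))
    then show "coeff (coeff F j) i = coeff (coeff (cubic_poly f) j) i"
      using k(1) by (auto simp: coeff_cubic_poly G_def f_def field_simps split: if_splits)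
  qed
  \<comment> \<open>Otherwise all cubic coefficients of \<open>f\<close> vanish, against total
    degree 3.\<close>
  have "s - t \<noteq> 0"
    using cubic_poly_leading_form_nonzero[of f] td unfolding \<open>F = cubic_poly f\<close>
    by (auto simp: f_def g simp del: One_nat_def)
  define p where "p = (u - v) / (s - t)"
  have "circular_focus f = p"
  proof -
    have "f 2 0 - f 0 2 = 2 * Im (v - u) / k" using g(5) by (simp only: f_def flip: diff_divide_distrib)
    moreover have "f 1 1 = - 2 * Re (v - u) / k" "f 3 0 = Im (s - t) / k" "f 0 3 = - Re (s - t) / k"
      by (simp_all only: f_def g)
    \<comment> \<open>The two numbers defining the focus share the factor - i / k, which cancels in
      the quotient.\<close>
    ultimately have "Complex (f 2 0 - f 0 2) (f 1 1) = - 2 * \<i> * (v - u) / of_real k"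
      "Complex (f 3 0) (f 0 3) = - \<i> * (s - t) / of_real k"
      using k(1) by (simp_all add: complex_eq_iff field_simps del: One_nat_def)
    then have "circular_focus f = - (- 2 * \<i> * (v - u) / of_real k) / (2 * (- \<i> * (s - t) / of_real k))"
      unfolding circular_focus_def by (simp only:)
    also have "\<dots> = p" using k(1) \<open>s - t \<noteq> 0\<close> by (simp add: p_def field_simps)
    finally show ?thesis .
  qed
  moreover have "p \<in> plane_curve F"
  proof -
    have "(s - t) * p = u - v" using \<open>s - t \<noteq> 0\<close> by (simp add: p_def)
    then have "(p - b) * (p - d) = (p - a) * (p - c)" by (simp add: suv algebra_simps)
    then show ?thesis unfolding F isogonal_cubic_eq mem_Collect_eq by (simp only: mult.commute)
  qed
  ultimately show ?thesis
    using circular_points_condition_cubic_poly[of f] td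
    unfolding \<open>F = cubic_poly f\<close>[symmetric] by (simp add: f_def g del: One_nat_def)
qed

section \<open>From the circular points to isogonality\<close>

text \<open>For nonzero \<open>k\<close> the roots form the fibre of w -> l w + k / w over
  \<open>t\<close>; the second hypothesis excludes the branch values of this map.\<close>

lemma quadratic_roots:
  fixes l t k :: complex
  assumes "l \<noteq> 0" "t\<^sup>2 \<noteq> 4 * l * k"
  obtains a c where "a \<noteq> c" "\<And>w. l * (w - a) * (w - c) = l * w\<^sup>2 - t * w + k"
proof -
  define q where "q = csqrt (t\<^sup>2 - 4 * l * k)"
  define a c where "a = (t + q) / (2 * l)" "c = (t - q) / (2 * l)"
  have q: "q\<^sup>2 = t\<^sup>2 - 4 * l * k" by (simp add: q_def)
  with assms have "q \<noteq> 0" by auto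
  have sum: "2 * l * a = t + q" and diff: "2 * l * c = t - q"
    using assms(1) by (simp_all add: a_c_def)
  have "2 * (l * (a + c)) = 2 * t" using sum diff by algebra
  then have ac1: "t = l * (a + c)" by simp
  have "(4 * l) * (l * (a * c)) = (4 * l) * k" using sum diff q by algebra
  then have ac2: "k = l * (a * c)" using assms(1) by simp
  show ?thesis
  proof (rule that)
    show "a \<noteq> c" using \<open>q \<noteq> 0\<close> assms(1) by (auto simp: a_c_def)
    show "l * (w - a) * (w - c) = l * w\<^sup>2 - t * w + k" for w
      unfolding ac1 ac2 by (simp add: algebra_simps power2_eq_square)
  qed
qed

lemma circular_points_condition_imp_isogonal:
  fixes c :: "nat \<Rightarrow> nat \<Rightarrow> real"
  defines "F \<equiv> cubic_poly c"
  assumes td: "total_degree F = 3" and irr: "irreducible F"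
    and circ: "c 3 0 = c 1 2" "c 2 1 = c 0 3" and focus: "circular_focus c \<in> plane_curve F"
  shows "\<exists>A B C D. distinct [A, B, C, D] \<and> plane_curve F = isogonal_cubic A B C D"
proof -
  define p where "p = circular_focus c"
  define X Y where "X = Re p" "Y = Im p"
  define \<alpha> \<beta> where "\<alpha> = c 3 0" "\<beta> = c 0 3"
  \<comment> \<open>The coefficient of \<open>W\<^sup>2\<close> once \<open>p\<close> is moved to
    the origin. The formula for the focus makes it the coefficient of \<open>V\<^sup>2\<close> too
    and removes the mixed term.\<close>
  define n where "n = c 2 0 + 3 * \<alpha> * X + \<beta> * Y"
  \<comment> \<open>\<open>(kx, ky)\<close> is the gradient at \<open>p\<close>.\<close>
  define kx where "kx = 3 * \<alpha> * X\<^sup>2 + 2 * \<beta> * X * Y + \<alpha> * Y\<^sup>2 + 2 * c 2 0 * X + c 1 1 * Y + c 1 0"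
  define ky where "ky = \<beta> * X\<^sup>2 + 2 * \<alpha> * X * Y + 3 * \<beta> * Y\<^sup>2 + c 1 1 * X + 2 * c 0 2 * Y + c 0 1"
  \<comment> \<open>The sign gives Re (l w) = \<alpha> Re w + \<beta> Im w.\<close>
  define l where "l = Complex \<alpha> (- \<beta>)"
  define k where "k = Complex kx ky"
  have c3: "c 3 0 = \<alpha>" "c 1 2 = \<alpha>" "c 2 1 = \<beta>" "c 0 3 = \<beta>" using circ by (simp_all add: \<alpha>_\<beta>_def)
  have l0: "l \<noteq> 0"
    using cubic_poly_leading_form_nonzero[OF td[unfolded F_def]] c3
    by (auto simp: l_def complex_eq_iff)
  have c2: "c 2 0 = c 0 2 - 2 * (\<alpha> * X - \<beta> * Y)" "c 1 1 = - 2 * (\<alpha> * Y + \<beta> * X)"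
  proof -
    have "Complex \<alpha> \<beta> \<noteq> 0" using l0 by (auto simp: l_def complex_eq_iff)
    then have "2 * Complex \<alpha> \<beta> * p = - Complex (c 2 0 - c 0 2) (c 1 1)"
      by (simp add: p_def circular_focus_def \<alpha>_\<beta>_def)
    then show "c 2 0 = c 0 2 - 2 * (\<alpha> * X - \<beta> * Y)" "c 1 1 = - 2 * (\<alpha> * Y + \<beta> * X)"
      by (simp_all add: complex_eq_iff X_Y_def)
  qed
  have c1: "c 1 0 = kx - (3 * \<alpha> * X\<^sup>2 + 2 * \<beta> * X * Y + \<alpha> * Y\<^sup>2 + 2 * c 2 0 * X + c 1 1 * Y)"
    "c 0 1 = ky - (\<beta> * X\<^sup>2 + 2 * \<alpha> * X * Y + 3 * \<beta> * Y\<^sup>2 + c 1 1 * X + 2 * c 0 2 * Y)"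
    by (simp_all add: kx_def ky_def)
  have "poly (poly F [:Y:]) X = 0" using focus by (simp add: plane_curve_def p_def X_Y_def)
  then have c0: "c 0 0 = - (\<alpha> * X ^ 3 + \<beta> * X ^ 2 * Y + \<alpha> * X * Y ^ 2 + \<beta> * Y ^ 3
      + c 2 0 * X ^ 2 + c 1 1 * X * Y + c 0 2 * Y ^ 2 + c 1 0 * X + c 0 1 * Y)"
    unfolding F_def poly_cubic_poly c3 by linarith
  have expand: "poly (poly F [:Y + V:]) (X + W) =
      (W\<^sup>2 + V\<^sup>2) * (\<alpha> * W + \<beta> * V + n) + kx * W + ky * V" for W V
    unfolding F_def poly_cubic_poly c3 c0 c1 n_def c2
    by (simp add: algebra_simps power2_eq_square power3_eq_cube)
  \<comment> \<open>With zero gradient at \<open>p\<close> the equation splits into the isotropic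
    lines \<open>Q\<close> through \<open>p\<close> and a line \<open>L\<close>.\<close>
  have k0: "k \<noteq> 0"
  proof
    assume "k = 0"
    then have k: "kx = 0" "ky = 0" by (simp_all add: k_def complex_eq_iff)
    define Q L :: "real poly poly" where "Q = [:[:X\<^sup>2 + Y\<^sup>2, - 2 * X, 1:], [:- 2 * Y:], 1:]"
      "L = [:[:n - \<alpha> * X - \<beta> * Y, \<alpha>:], [:\<beta>:]:]"
    note QL = this
    have "F = Q * L"
      unfolding F_def cubic_poly_def QL c3 c0 c1 n_def c2 k
      by (simp add: one_pCons algebra_simps power2_eq_square power3_eq_cube)
    with irr have "Q dvd 1 \<or> L dvd 1" using irreducibleD by blast
    moreover have "\<not> Q dvd 1" by (auto simp: QL is_unit_poly_iff)
    moreover have "\<not> L dvd 1"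
      using l0 by (auto simp: QL is_unit_poly_iff l_def complex_eq_iff)
    ultimately show False by blast
  qed
  define M where "M w = l * w\<^sup>2 + of_real n * w + k" for w
  have curve: "x \<in> plane_curve F \<longleftrightarrow> Re (M (x - p) * cnj (x - p)) = 0" for x
  proof -
    define w where "w = x - p"
    have "Re x = X + Re w" "Im x = Y + Im w" by (simp_all add: w_def X_Y_def)
    then have "poly (poly F [:Im x:]) (Re x) = Re (M w * cnj w)"
      by (simp only: expand) (simp add: M_def l_def k_def algebra_simps power2_eq_square)
    then show ?thesis by (simp add: plane_curve_def w_def)
  qed
  \<comment> \<open>The branch values are \<open>q\<close> and \<open>- q\<close>. Both
    \<open>t1\<close> and \<open>t2\<close> are taken on the line Re = - n, high enough to avoid
    them.\<close>
  define q where "q = csqrt (4 * l * k)"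
  define r where "r = \<bar>Im q\<bar> + 1"
  define t1 t2 where "t1 = - of_real n + \<i> * of_real r" "t2 = - of_real n + \<i> * of_real (r + 1)"
  have "t\<^sup>2 \<noteq> 4 * l * k" if "Im t > \<bar>Im q\<bar>" for t
  proof
    assume "t\<^sup>2 = 4 * l * k"
    also have "\<dots> = q\<^sup>2" by (simp add: q_def)
    finally have "t = q \<or> t = - q" by (simp add: power2_eq_iff)
    with that show False by auto
  qed
  then have t12: "t1\<^sup>2 \<noteq> 4 * l * k" "t2\<^sup>2 \<noteq> 4 * l * k" by (simp_all add: t1_t2_def r_def)
  obtain a c' where ac: "a \<noteq> c'" "\<And>w. l * (w - a) * (w - c') = l * w\<^sup>2 - t1 * w + k"
    using quadratic_roots[OF l0 t12(1)] by metis
  obtain b d where bd: "b \<noteq> d" "\<And>w. l * (w - b) * (w - d) = l * w\<^sup>2 - t2 * w + k"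
    using quadratic_roots[OF l0 t12(2)] by metis
  \<comment> \<open>Subtracting the two equations leaves only w = 0, where both quadratics take the
    value \<open>k\<close>.\<close>
  have disj: False if "w \<in> {a, c'}" "w \<in> {b, d}" for w
  proof -
    have 1: "l * w\<^sup>2 - t1 * w + k = 0" using that(1) by (auto simp flip: ac(2))
    have 2: "l * w\<^sup>2 - t2 * w + k = 0" using that(2) by (auto simp flip: bd(2))
    have "(t1 - t2) * w = 0" using 1 2 by algebra
    moreover have "t1 - t2 \<noteq> 0" by (simp add: t1_t2_def complex_eq_iff)
    ultimately have "w = 0" by simp
    with 1 k0 show False by simp
  qed
  have "plane_curve F = isogonal_cubic (p + a) (p + b) (p + c') (p + d)"
  proof (intro set_eqI)
    fix x
    define w where "w = x - p"
    define N where "N = (w - b) * (w - d) * cnj ((w - a) * (w - c'))"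
    \<comment> \<open>The factor supplies the leading coefficient \<open>l\<close> to both
      quadratics, which then differ from \<open>M w\<close> by imaginary multiples of
      \<open>w\<close>.\<close>
    have "of_real ((norm l)\<^sup>2) * N = (l * (w - b) * (w - d)) * cnj (l * (w - a) * (w - c'))"
      unfolding N_def complex_norm_square by (simp add: mult_ac)
    also have "\<dots> = (M w - \<i> * of_real (r + 1) * w) * cnj (M w - \<i> * of_real r * w)"
      unfolding ac(2) bd(2) M_def t1_t2_def by (simp add: algebra_simps)
    finally have eq: "of_real ((norm l)\<^sup>2) * N = \<dots>" .
    define R where "R = Re (M w * cnj w)"
    have "(norm l)\<^sup>2 * Im N = Im (of_real ((norm l)\<^sup>2) * N)" by simp
    \<comment> \<open>The terms in |M w|^2 and |w|^2 are real; the mixed ones contribute r R - (r +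
      1) R.\<close>
    also have "\<dots> = - R" unfolding eq R_def by (simp add: algebra_simps)
    finally have "Im N = 0 \<longleftrightarrow> R = 0" using l0 by auto
    moreover have "x \<in> isogonal_cubic (p + a) (p + b) (p + c') (p + d) \<longleftrightarrow> Im N = 0"
      unfolding isogonal_cubic_eq mem_Collect_eq mult_cnj_eq_iff_Im N_def w_def
      by (simp only: diff_diff_eq)
    ultimately show "x \<in> plane_curve F \<longleftrightarrow> x \<in> isogonal_cubic (p + a) (p + b) (p + c') (p + d)"
      by (simp only: curve w_def R_def)
  qed
  moreover have "distinct [p + a, p + b, p + c', p + d]"
    using ac(1) bd(1) disj by auto
  ultimately show ?thesis by blast
qed

theorem theorem1p1:
  fixes F :: "real poly poly"
  assumes "total_degree F = 3" and "irreducible F"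
  shows "(\<exists>A B C D. distinct [A, B, C, D] \<and> {A, B, C, D} \<subseteq> plane_curve F \<and>
            plane_curve F = isogonal_cubic A B C D)
     \<longleftrightarrow> (circular_I \<in> proj_curve F \<and> circular_J \<in> proj_curve F \<and>
          (\<exists>P \<in> proj_curve F. P \<in> tangent_line F circular_I \<and> P \<in> tangent_line F circular_J))"
    (is "?isogonal \<longleftrightarrow> ?circular")
proof
  assume ?isogonal
  then show ?circular using isogonal_imp_circular_points_condition[OF assms] by blast
next
  assume circ: ?circular
  define c where "c i j = coeff (coeff F j) i" for i j
  have F: "F = cubic_poly c" unfolding c_def using assms(1) by (intro cubic_poly_coeffs) simp
  from circ circular_points_condition_cubic_poly[of c] assms(1)
  have "c 3 0 = c 1 2 \<and> c 2 1 = c 0 3 \<and> circular_focus c \<in> plane_curve F"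
    unfolding F by blast
  then obtain A B C D where "distinct [A, B, C, D]" "plane_curve F = isogonal_cubic A B C D"
    using circular_points_condition_imp_isogonal[of c] assms unfolding F by blast
  moreover have "{A, B, C, D} \<subseteq> isogonal_cubic A B C D" by (simp add: isogonal_cubic_def)
  ultimately show ?isogonal by metis
qed

end
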